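(* Let $X$ be a separable locally convex Hausdorff topological vector space over $\mathbb{K}\in\{\mathbb{R},\mathbb{C}\}$. If $X$ is countably separated, then its continuous dual $X'$ is separable with respect to the weak topology $\sigma(X',X)$.
   Context: $\sigma(X',X)$ is the weak topology on $X'$ induced by the pairing with $X$ (the weak* topology). A null neighborhood is a neighborhood of the origin. For $A\subseteq X$ the polar is $A^\circ=\{x'\in X' : \operatorname{Re}\langle x',x\rangle\le 1 \text{ for all } x\in A\}$, and for $B\subseteq X'$, $x\in X$, the support function is $S(B,x)=\sup_{x'\in B}\operatorname{Re}\langle x',x\rangle$ (real parts are superfluous if $\mathbb{K}=\mathbb{R}$). A locally convex Hausdorff space $X$ is called countably separated if there is a sequence $(U_n)_{n\ge1}$ of absolutely convex, closed null neighborhoods in $X$ with $\bigcap_{n\ge 1}\{x\in X : S(U_n^\circ,x)=0\}=\{0\}$. Convention: separability of $X'$ is understood for $\sigma(X',X)$; separability is the same for every locally convex topology on $X'$ compatible with the duality $(X,X')$ (i.e. one for which the continuous dual of $X'$ is $X$). *)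

theory Defs
  imports "HOL-Analysis.Analysis"
begin

text \<open>
  The scalar field \<open>\<K>\<close>. A type of this class is a normed field over the reals together with an
  isometric embedding into the complex numbers, so it is a copy of either \<open>\<real>\<close> or \<open>\<complex>\<close>
  (lemma \<open>range_to_complex\<close>); both occur as instances. The embedding only serves to give a
  uniform meaning to the real part of a scalar.
\<close>

class real_or_complex = real_normed_field +
  fixes to_complex :: "'a \<Rightarrow> complex"
  assumes to_complex_add: "to_complex (a + b) = to_complex a + to_complex b"
    and to_complex_mult: "to_complex (a * b) = to_complex a * to_complex b"
    and to_complex_scaleR: "to_complex (r *\<^sub>R a) = r *\<^sub>R to_complex a"
    and norm_to_complex: "norm (to_complex a) = norm a"

instantiation real :: real_or_complex
begin

definition "to_complex_real = (complex_of_real :: real \<Rightarrow> complex)"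

instance
  by standard (simp_all add: to_complex_real_def scaleR_conv_of_real)

end

instantiation complex :: real_or_complex
begin

definition "to_complex_complex = (\<lambda>z :: complex. z)"

instance
  by standard (simp_all add: to_complex_complex_def)

end

definition re :: "'k::real_or_complex \<Rightarrow> real" where
  "re a = Re (to_complex a)"

lemma re_real [simp]: "re (a :: real) = a"
  by (simp add: re_def to_complex_real_def)

lemma re_complex [simp]: "re (z :: complex) = Re z"
  by (simp add: re_def to_complex_complex_def)

lemma to_complex_of_real:
  "to_complex (of_real r :: 'k::real_or_complex) = of_real r"
proof -
  let ?e = "to_complex (1 :: 'k)"
  have "?e * ?e = ?e"
    by (simp flip: to_complex_mult)
  moreover have "?e \<noteq> 0"
    using norm_to_complex[of "1 :: 'k"] by auto
  ultimately have "?e = 1"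
    by simp
  then show ?thesis
    by (simp add: of_real_def to_complex_scaleR)
qed

lemma inj_to_complex: "inj (to_complex :: 'k::real_or_complex \<Rightarrow> complex)"
proof (rule injI)
  fix a b :: 'k
  assume "to_complex a = to_complex b"
  moreover have "to_complex a = to_complex (a - b) + to_complex b"
    by (simp flip: to_complex_add)
  ultimately have "to_complex (a - b) = 0"
    by simp
  then have "norm (a - b) = 0"
    using norm_to_complex[of "a - b"] by simp
  then show "a = b"
    by simp
qed

lemma range_to_complex:
  "range (to_complex :: 'k::real_or_complex \<Rightarrow> complex) = \<real> \<or>
   range (to_complex :: 'k \<Rightarrow> complex) = UNIV"
proof (cases "range (to_complex :: 'k \<Rightarrow> complex) \<subseteq> \<real>")
  case True
  moreover have "\<real> \<subseteq> range (to_complex :: 'k \<Rightarrow> complex)"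
    unfolding Reals_def by (metis image_subsetI rangeI to_complex_of_real)
  ultimately show ?thesis
    by blast
next
  case False
  then obtain a :: 'k where a: "Im (to_complex a) \<noteq> 0"
    unfolding image_subset_iff complex_is_Real_iff by blast
  have "z \<in> range (to_complex :: 'k \<Rightarrow> complex)" for z
  proof -
    define t where "t = Im z / Im (to_complex a)"
    define s where "s = Re z - t * Re (to_complex a)"
    have "to_complex (of_real s + t *\<^sub>R a) = of_real s + t *\<^sub>R to_complex a"
      by (simp add: to_complex_add to_complex_scaleR to_complex_of_real)
    also have "\<dots> = z"
      using a by (simp add: complex_eq_iff s_def t_def)
    finally show ?thesis
      by (metis rangeI)
  qed
  then show ?thesis
    by blast
qed

definition convex_wrt :: "('k::real_or_complex \<Rightarrow> 'a::ab_group_add \<Rightarrow> 'a) \<Rightarrow> 'a set \<Rightarrow> bool" where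
  "convex_wrt scaleK U \<longleftrightarrow>
     (\<forall>x\<in>U. \<forall>y\<in>U. \<forall>s\<ge>0. \<forall>t\<ge>0. s + t = 1 \<longrightarrow>
        scaleK (of_real s) x + scaleK (of_real t) y \<in> U)"

definition absolutely_convex ::
    "('k::real_or_complex \<Rightarrow> 'a::ab_group_add \<Rightarrow> 'a) \<Rightarrow> 'a set \<Rightarrow> bool" where
  "absolutely_convex scaleK U \<longleftrightarrow>
     (\<forall>x\<in>U. \<forall>y\<in>U. \<forall>a b. norm a + norm b \<le> 1 \<longrightarrow> scaleK a x + scaleK b y \<in> U)"

definition null_neighborhood :: "'a::{zero, topological_space} set \<Rightarrow> bool" where
  "null_neighborhood U \<longleftrightarrow> 0 \<in> interior U"

text \<open>
  Addition is continuous and the topology is Hausdorff by the type classes of \<open>'a\<close>.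
\<close>

locale locally_convex_hausdorff_space = vector_space scaleK
  for scaleK :: "'k::real_or_complex \<Rightarrow> 'a::{topological_ab_group_add, t2_space} \<Rightarrow> 'a" +
  assumes continuous_scaleK: "continuous_on UNIV (\<lambda>(a, x). scaleK a x)"
    and locally_convex:
      "null_neighborhood V \<Longrightarrow> \<exists>U. null_neighborhood U \<and> convex_wrt scaleK U \<and> U \<subseteq> V"

definition continuous_dual ::
    "('k::real_or_complex \<Rightarrow> 'a::{ab_group_add, topological_space} \<Rightarrow> 'a) \<Rightarrow> ('a \<Rightarrow> 'k) set" where
  "continuous_dual scaleK = {f. Vector_Spaces.linear scaleK (*) f \<and> continuous_on UNIV f}"

text \<open>The coarsest topology on the dual that makes all evaluations \<open>f \<mapsto> f x\<close> continuous.\<close>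

definition weak_star_topology ::
    "('k::real_or_complex \<Rightarrow> 'a::{ab_group_add, topological_space} \<Rightarrow> 'a) \<Rightarrow> ('a \<Rightarrow> 'k) topology" where
  "weak_star_topology scaleK =
     topology_generated_by {{f \<in> continuous_dual scaleK. f x \<in> W} | x W. open W}"

lemma topspace_weak_star_topology [simp]:
  "topspace (weak_star_topology scaleK) = continuous_dual scaleK"
  unfolding weak_star_topology_def topology_generated_by_topspace by blast

definition polar ::
    "('k::real_or_complex \<Rightarrow> 'a::{ab_group_add, topological_space} \<Rightarrow> 'a) \<Rightarrow> 'a set \<Rightarrow> ('a \<Rightarrow> 'k) set" where
  "polar scaleK A = {f \<in> continuous_dual scaleK. \<forall>x\<in>A. re (f x) \<le> 1}"

text \<open>The supremum is taken in the extended reals, so that it is meaningful for every \<open>B\<close>.\<close>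

definition support_function :: "('a \<Rightarrow> 'k::real_or_complex) set \<Rightarrow> 'a \<Rightarrow> ereal" where
  "support_function B x = (SUP f\<in>B. ereal (re (f x)))"

definition countably_separated ::
    "('k::real_or_complex \<Rightarrow> 'a::{ab_group_add, topological_space} \<Rightarrow> 'a) \<Rightarrow> bool" where
  "countably_separated scaleK \<longleftrightarrow>
     (\<exists>U :: nat \<Rightarrow> 'a set.
        (\<forall>n\<ge>1. absolutely_convex scaleK (U n) \<and> closed (U n) \<and> null_neighborhood (U n)) \<and>
        (\<Inter>n\<in>{1..}. {x. support_function (polar scaleK (U n)) x = 0}) = {0})"

end

theory Submission
  imports Defs
begin

text \<open>
  The idea is to exhibit inside the dual \<open>X'\<close> a subspace \<open>M\<close> that is weak* separable and weak*
  dense. Let \<open>V\<^sub>N\<close> be the intersection of the first \<open>N\<close> neighborhoods of a separating sequence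
  \<open>(U\<^sub>n)\<close>, and let \<open>H\<^sub>N\<close> consist of the continuous functionals bounded by \<open>N\<close> on \<open>V\<^sub>N\<close>. Put
  \<open>M = \<Union>\<^sub>N H\<^sub>N\<close>; this is the dual of \<open>X\<close> for the (coarser) locally convex topology generated by
  the \<open>U\<^sub>n\<close>. Taking this union, rather than the span of the polars \<open>U\<^sub>n\<degree>\<close>, yields a linear subspace
  directly as a countable union of equicontinuous sets.

  Separability of \<open>M\<close>: on an equicontinuous set such as \<open>H\<^sub>N\<close> the weak* topology coincides with
  pointwise convergence on a countable dense subset of \<open>X\<close>. So \<open>H\<^sub>N\<close> embeds into a countable power
  of the scalar field, which is second countable, and every subset of such a space is separable
  (lemma \<open>bounded_on_null_neighborhood_separable\<close>).

  Density of \<open>M\<close>: since \<open>M\<close> contains every polar \<open>U\<^sub>n\<degree>\<close>, a vector annihilated by \<open>M\<close> has support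
  function \<open>0\<close> on all of them and is therefore \<open>0\<close>. A subspace of functionals that separates points
  interpolates every functional on every finite set of vectors, by plain linear algebra (lemma
  \<open>separating_subspace_interpolates\<close>). Basic weak* neighborhoods only see finitely many
  vectors, so \<open>M\<close> meets all of them.
\<close>

section \<open>The continuous dual as a space of functions\<close>

lemma re_of_real [simp]: "re (of_real r :: 'k::real_or_complex) = r"
  by (simp add: re_def to_complex_of_real)

lemma re_zero [simp]: "re (0 :: 'k::real_or_complex) = 0"
  using re_of_real[of 0, where 'k = 'k] by simp

lemma continuous_dualI:
  assumes "vector_space (scaleK :: 'k::real_or_complex \<Rightarrow> 'a::{ab_group_add, topological_space} \<Rightarrow> 'a)"
    and "\<And>x y. f (x + y) = f x + f y"
    and "\<And>a x. f (scaleK a x) = a * f x"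
    and "continuous_on UNIV f"
  shows "f \<in> continuous_dual scaleK"
proof -
  have "vector_space ((*) :: 'k \<Rightarrow> 'k \<Rightarrow> 'k)"
    by standard (auto simp: algebra_simps)
  then show ?thesis
    using assms by (simp add: continuous_dual_def Vector_Spaces.linear_iff)
qed

lemma continuous_dualD:
  assumes "f \<in> continuous_dual scaleK"
  shows continuous_dual_add: "f (x + y) = f x + f y"
    and continuous_dual_scale: "f (scaleK a x) = a * f x"
    and continuous_dual_continuous: "continuous_on UNIV f"
  using assms by (auto simp: continuous_dual_def Vector_Spaces.linear_iff)

lemma continuous_dual_zero:
  assumes "f \<in> continuous_dual scaleK"
  shows "f 0 = 0"
  using continuous_dual_add[OF assms, of 0 0] by simp

lemma continuous_dual_diff:
  assumes "f \<in> continuous_dual scaleK"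
  shows "f (x - y) = f x - f y"
  using continuous_dual_add[OF assms, of "x - y" y] by simp

lemma zero_in_continuous_dual:
  assumes "vector_space scaleK"
  shows "(\<lambda>x. 0) \<in> continuous_dual scaleK"
  by (rule continuous_dualI[OF assms]) auto

lemma add_scale_in_continuous_dual:
  assumes "vector_space scaleK" "f \<in> continuous_dual scaleK" "h \<in> continuous_dual scaleK"
  shows "(\<lambda>x. f x + a * h x) \<in> continuous_dual scaleK"
proof (rule continuous_dualI[OF assms(1)])
  show "continuous_on UNIV (\<lambda>x. f x + a * h x)"
    by (intro continuous_on_add continuous_on_mult continuous_on_const
        continuous_dual_continuous[OF assms(2)] continuous_dual_continuous[OF assms(3)])
qed (simp_all add: continuous_dual_add[OF assms(2)] continuous_dual_add[OF assms(3)]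
    continuous_dual_scale[OF assms(2)] continuous_dual_scale[OF assms(3)] algebra_simps)

section \<open>Finite interpolation by separating subspaces\<close>

text \<open>
  The reason is that \<open>y\<close> has to lie in the span of \<open>F\<close>, on which \<open>g\<close> vanishes; the induction goes
  through without naming the span. If some \<open>h \<in> M\<close> vanishes on \<open>F\<close> but not at the new vector \<open>z\<close>,
  then moving \<open>y\<close> along \<open>z\<close> into the kernel of \<open>h\<close> produces a vector at which every element of
  \<open>M\<close> that vanishes on \<open>F\<close> vanishes; if there is no such \<open>h\<close>, the vector \<open>z\<close> adds no condition.
\<close>

lemma vanishing_transfer:
  assumes M: "M \<subseteq> continuous_dual scaleK"
    and comb: "\<And>f h a. f \<in> M \<Longrightarrow> h \<in> M \<Longrightarrow> (\<lambda>x. f x + a * h x) \<in> M"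
    and separating: "\<And>x. (\<And>f. f \<in> M \<Longrightarrow> f x = 0) \<Longrightarrow> x = 0"
    and g: "g \<in> continuous_dual scaleK"
    and "finite F"
    and "\<And>x. x \<in> F \<Longrightarrow> g x = 0"
    and "\<And>f. f \<in> M \<Longrightarrow> (\<And>x. x \<in> F \<Longrightarrow> f x = 0) \<Longrightarrow> f y = 0"
  shows "g y = 0"
  using assms(5-7)
proof (induction F arbitrary: y rule: finite_induct)
  case empty
  then have "y = 0"
    by (intro separating) auto
  then show ?case
    by (simp add: continuous_dual_zero[OF g])
next
  case (insert z F)
  show ?case
  proof (cases "\<exists>h\<in>M. (\<forall>x\<in>F. h x = 0) \<and> h z \<noteq> 0")
    case False
    show ?thesis
    proof (rule insert.IH)
      show "f y = 0" if f: "f \<in> M" "\<And>x. x \<in> F \<Longrightarrow> f x = 0" for f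
      proof (rule insert.prems(2)[OF f(1)])
        show "f x = 0" if "x \<in> insert z F" for x
          using that False f by auto
      qed
    qed (use insert.prems(1) in simp)
  next
    case True
    then obtain h where h: "h \<in> M" "\<And>x. x \<in> F \<Longrightarrow> h x = 0" "h z \<noteq> 0"
      by blast
    define w where "w = y - scaleK (h y / h z) z"
    \<comment> \<open>Correcting \<open>f\<close> by a multiple of \<open>h\<close> makes it vanish at \<open>z\<close> as well, hence at \<open>y\<close>.\<close>
    have vanish: "f w = 0" if f: "f \<in> M" "\<And>x. x \<in> F \<Longrightarrow> f x = 0" for f
    proof -
      have "f y + (- (f z / h z)) * h y = 0"
        by (rule insert.prems(2)[OF comb[OF f(1) h(1)]]) (use f h in auto)
      moreover have "f w = f y - h y / h z * f z"
        using f(1) M by (auto simp: w_def continuous_dual_diff continuous_dual_scale)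
      ultimately show ?thesis
        by (simp add: field_simps)
    qed
    have "g w = 0"
      by (rule insert.IH[OF _ vanish]) (use insert.prems(1) in simp_all)
    moreover have "g w = g y - h y / h z * g z"
      by (simp add: w_def continuous_dual_diff[OF g] continuous_dual_scale[OF g])
    ultimately show ?thesis
      using insert.prems(1) by simp
  qed
qed

text \<open>
  One interpolation point at a time: an interpolant \<open>f\<close> on \<open>F\<close> is corrected at \<open>y\<close> by an element of
  \<open>M\<close> that vanishes on \<open>F\<close> but not at \<open>y\<close>. If none exists, lemma \<open>vanishing_transfer\<close> applied
  to \<open>g - f\<close> shows that \<open>f\<close> is already correct at \<open>y\<close>.
\<close>

lemma separating_subspace_interpolates:
  assumes vs: "vector_space scaleK"
    and M: "M \<subseteq> continuous_dual scaleK"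
    and zero: "(\<lambda>x. 0) \<in> M"
    and comb: "\<And>f h a. f \<in> M \<Longrightarrow> h \<in> M \<Longrightarrow> (\<lambda>x. f x + a * h x) \<in> M"
    and separating: "\<And>x. (\<And>f. f \<in> M \<Longrightarrow> f x = 0) \<Longrightarrow> x = 0"
    and g: "g \<in> continuous_dual scaleK"
    and "finite F"
  shows "\<exists>f\<in>M. \<forall>x\<in>F. f x = g x"
  using \<open>finite F\<close>
proof (induction F rule: finite_induct)
  case empty
  then show ?case
    using zero by auto
next
  case (insert y F)
  then obtain f where f: "f \<in> M" "\<And>x. x \<in> F \<Longrightarrow> f x = g x"
    by blast
  show ?case
  proof (cases "\<exists>h\<in>M. (\<forall>x\<in>F. h x = 0) \<and> h y \<noteq> 0")
    case True
    then obtain h where h: "h \<in> M" "\<And>x. x \<in> F \<Longrightarrow> h x = 0" "h y \<noteq> 0"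
      by blast
    show ?thesis
      by (rule bexI[OF _ comb[OF f(1) h(1), of "(g y - f y) / h y"]]) (use f h in auto)
  next
    case False
    have dual: "(\<lambda>x. g x + -1 * f x) \<in> continuous_dual scaleK"
      using f(1) M by (intro add_scale_in_continuous_dual[OF vs g]) auto
    have "g y + -1 * f y = 0"
    proof (rule vanishing_transfer[OF M _ _ dual \<open>finite F\<close>])
      show "g x + -1 * f x = 0" if "x \<in> F" for x
        using f(2)[OF that] by simp
      show "h y = 0" if "h \<in> M" "\<And>x. x \<in> F \<Longrightarrow> h x = 0" for h
        using False that by blast
    qed (use comb separating in blast)+
    then show ?thesis
      using f by auto
  qed
qed

section \<open>Weak* neighborhoods and equicontinuous sets\<close>

lemma weak_star_basic_neighborhood:
  fixes scaleK :: "'k::real_or_complex \<Rightarrow> 'a::{ab_group_add, topological_space} \<Rightarrow> 'a"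
  assumes "openin (weak_star_topology scaleK) T" "g \<in> T"
  shows "\<exists>F e. finite F \<and> e > 0 \<and>
    {f \<in> continuous_dual scaleK. \<forall>x\<in>F. norm (f x - g x) < e} \<subseteq> T"
proof -
  have "generate_topology_on {{f \<in> continuous_dual scaleK. f x \<in> W} | x W. open W} T"
    using assms(1) by (simp add: weak_star_topology_def openin_topology_generated_by_iff)
  then show ?thesis
    using assms(2)
  proof (induction T rule: generate_topology_on.induct)
    case Empty
    then show ?case by simp
  next
    case (Int S T)
    then have "g \<in> S" "g \<in> T"
      by auto
    from Int.IH(1)[OF this(1)] obtain F e where "finite F" "e > 0"
      "{f \<in> continuous_dual scaleK. \<forall>x\<in>F. norm (f x - g x) < e} \<subseteq> S"
      by blast
    moreover from Int.IH(2)[OF \<open>g \<in> T\<close>] obtain F' e' where "finite F'" "e' > 0"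
      "{f \<in> continuous_dual scaleK. \<forall>x\<in>F'. norm (f x - g x) < e'} \<subseteq> T"
      by blast
    ultimately show ?case
      by (intro exI[of _ "F \<union> F'"] exI[of _ "min e e'"]) auto
  next
    case (UN K)
    then obtain S where "S \<in> K" "g \<in> S" by blast
    from UN.IH[OF this] show ?case
      using \<open>S \<in> K\<close> by (meson Union_upper order_trans)
  next
    case (Basis S)
    then obtain x W where S: "S = {f \<in> continuous_dual scaleK. f x \<in> W}" "open W"
      by blast
    with Basis obtain e where "e > 0" "ball (g x) e \<subseteq> W"
      by (auto elim: openE)
    then show ?case
      unfolding S by (intro exI[of _ "{x}"] exI[of _ e]) (auto simp: dist_norm norm_minus_commute)
  qed
qed

text \<open>
  The members of \<open>H\<close> are equicontinuous, so their values at an arbitrary vector are controlled,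
  uniformly over \<open>H\<close>, by their values at a nearby point of a countable dense set. Recording only the
  latter maps \<open>H\<close> into the separable metric space of complex sequences with the product topology.
  The approximating set is drawn from \<open>H\<close> itself because the estimate applies to both
  functionals.
\<close>

lemma bounded_on_null_neighborhood_separable:
  fixes scaleK :: "'k::real_or_complex \<Rightarrow> 'a::{topological_ab_group_add, t2_space} \<Rightarrow> 'a"
  assumes X: "locally_convex_hausdorff_space scaleK"
    and sep: "separable_space (euclidean :: 'a topology)"
    and V: "null_neighborhood V"
    and H: "H \<subseteq> {f \<in> continuous_dual scaleK. \<forall>x\<in>V. norm (f x) \<le> k}"
  shows "\<exists>C. countable C \<and> C \<subseteq> H \<and>
    (\<forall>f\<in>H. \<forall>F e. finite F \<longrightarrow> e > 0 \<longrightarrow> (\<exists>h\<in>C. \<forall>x\<in>F. norm (h x - f x) < e))"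
proof -
  interpret locally_convex_hausdorff_space scaleK by (rule X)
  obtain D :: "'a set" where D: "countable D" "closure D = UNIV"
    using sep by (auto simp: separable_space_def)
  then have "D \<noteq> {}" by auto
  define d where "d = from_nat_into D"
  have d: "range d = D"
    using range_from_nat_into[OF \<open>D \<noteq> {}\<close> D(1)] by (simp add: d_def)
  define r :: "('a \<Rightarrow> 'k) \<Rightarrow> nat \<Rightarrow> complex" where "r f = (\<lambda>i. to_complex (f (d i)))" for f
  obtain T where T: "countable T" "T \<subseteq> r ` H" "r ` H \<subseteq> closure T"
    using separable[of "r ` H"] by blast
  obtain C where C: "countable C" "C \<subseteq> H" "T = r ` C"
    using T(1,2) by (metis countable_subset_image)
  have "\<exists>h\<in>C. \<forall>x\<in>F. norm (h x - f x) < e"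
    if f: "f \<in> H" and F: "finite F" and e: "e > 0" for f F and e :: real
  proof -
    \<comment> \<open>On the shrunken neighborhood \<open>{y. c y \<in> V}\<close> all of \<open>H\<close> is bounded by \<open>\<bar>k\<bar> / c < e / 3\<close>.\<close>
    define c where "c = 3 * (\<bar>k\<bar> + 1) / e"
    have c: "c > 0" "\<bar>k\<bar> / c < e / 3"
      using e by (auto simp: c_def field_simps)
    define N where "N = {y. scaleK (of_real c) y \<in> interior V}"
    have "continuous_on UNIV (\<lambda>y. scaleK (of_real c) y)"
      using continuous_on_compose2[OF continuous_scaleK, of UNIV "\<lambda>y. (of_real c, y)"]
      by (simp add: continuous_on_Pair)
    then have "open N"
      unfolding N_def using open_vimage[OF open_interior] by (auto simp: vimage_def)
    have "0 \<in> N"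
      using V by (simp add: N_def null_neighborhood_def)
    have small: "norm (h x - h y) < e / 3" if "h \<in> H" "x - y \<in> N" for h x y
    proof -
      have hd: "h \<in> continuous_dual scaleK"
        using that H by auto
      have "scaleK (of_real c) (x - y) \<in> V"
        using that(2) interior_subset by (auto simp: N_def)
      then have "norm (h (scaleK (of_real c) (x - y))) \<le> k"
        using that(1) H by auto
      then have "c * norm (h x - h y) \<le> k"
        using c(1) by (simp add: continuous_dual_scale[OF hd] continuous_dual_diff[OF hd] norm_mult)
      then have "norm (h x - h y) \<le> \<bar>k\<bar> / c"
        using c(1) by (simp add: field_simps)
      also note c(2)
      finally show ?thesis .
    qed
    have "\<exists>i. x - d i \<in> N" for x
    proof -
      have "open ((\<lambda>y. x - y) -` N)"
        by (intro open_vimage \<open>open N\<close> continuous_intros)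
      moreover have "x \<in> (\<lambda>y. x - y) -` N"
        using \<open>0 \<in> N\<close> by simp
      ultimately have "D \<inter> (\<lambda>y. x - y) -` N \<noteq> {}"
        using D(2) by (metis UNIV_I closure_iff_nhds_not_empty subset_refl)
      then show ?thesis
        using d by auto
    qed
    then obtain i where i: "\<And>x. x - d (i x) \<in> N"
      by metis
    define G where "G = (\<Inter>x\<in>F. (\<lambda>p :: nat \<Rightarrow> complex. p (i x)) -` ball (r f (i x)) (e / 3))"
    have "open G"
      unfolding G_def using F
      by (intro open_INT ballI open_vimage open_ball continuous_on_product_coordinates) auto
    moreover have "r f \<in> G"
      using e by (simp add: G_def)
    moreover have "r f \<in> closure T"
      using T(3) f by auto
    ultimately have "T \<inter> G \<noteq> {}"
      by (metis closure_iff_nhds_not_empty subset_refl)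
    then obtain h where h: "h \<in> C" "r h \<in> G"
      using C(3) by auto
    have "norm (h x - f x) < e" if "x \<in> F" for x
    proof -
      have "norm (to_complex (f (d (i x))) - to_complex (h (d (i x)))) < e / 3"
        using h(2) that by (auto simp: G_def r_def dist_norm)
      moreover have "to_complex (f (d (i x))) - to_complex (h (d (i x)))
          = to_complex (f (d (i x)) - h (d (i x)))"
        by (metis add_diff_cancel_right' diff_add_cancel to_complex_add)
      ultimately have 1: "norm (f (d (i x)) - h (d (i x))) < e / 3"
        by (simp add: norm_to_complex)
      have 2: "norm (h x - h (d (i x))) < e / 3" "norm (f x - f (d (i x))) < e / 3"
        using small i h(1) C(2) f by auto
      have "norm (h x - f x) \<le> norm (h x - h (d (i x))) + norm (f x - f (d (i x)))
          + norm (f (d (i x)) - h (d (i x)))"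
        by norm
      with 1 2 show ?thesis by linarith
    qed
    with h(1) show ?thesis by blast
  qed
  with C(1,2) show ?thesis
    by (intro exI[of _ C] conjI ballI allI impI)
qed

section \<open>Polars and support functions\<close>

text \<open>
  A polar only bounds real parts; because \<open>U\<close> is balanced, \<open>x\<close> may be rotated until \<open>f x\<close> is
  a nonnegative real.
\<close>

lemma polar_norm_le:
  assumes vs: "vector_space scaleK"
    and U: "absolutely_convex scaleK U"
    and f: "f \<in> polar scaleK U"
    and x: "x \<in> U"
  shows "norm (f x) \<le> 1"
proof (cases "f x = 0")
  case False
  interpret vector_space scaleK by (rule vs)
  have fd: "f \<in> continuous_dual scaleK"
    using f by (simp add: polar_def)
  define a where "a = of_real (norm (f x)) / f x"
  have "norm a = 1"
    using False by (simp add: a_def norm_divide)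
  then have "scaleK a x + scaleK 0 x \<in> U"
    using U x unfolding absolutely_convex_def by (metis add.right_neutral norm_zero order_refl)
  then have "scaleK a x \<in> U"
    by simp
  then have "re (f (scaleK a x)) \<le> 1"
    using f by (auto simp: polar_def)
  moreover have "f (scaleK a x) = of_real (norm (f x))"
    using False by (simp add: continuous_dual_scale[OF fd] a_def)
  ultimately show ?thesis
    by simp
qed simp

lemma support_function_eq_0:
  fixes B :: "('a \<Rightarrow> 'k::real_or_complex) set"
  assumes "B \<noteq> {}" "\<And>f. f \<in> B \<Longrightarrow> f x = 0"
  shows "support_function B x = 0"
proof -
  have "ereal (re (f x)) = 0" if "f \<in> B" for f
    using assms(2)[OF that] by simp
  then have "support_function B x = (SUP f\<in>B. 0)"
    unfolding support_function_def by (rule SUP_cong[OF refl])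
  with assms(1) show ?thesis by simp
qed

section \<open>Separability of the dual\<close>

theorem theorem3p4:
  fixes scaleK :: "'k::real_or_complex \<Rightarrow> 'a::{topological_ab_group_add, t2_space} \<Rightarrow> 'a"
  assumes "locally_convex_hausdorff_space scaleK"
    and "separable_space (euclidean :: 'a topology)"
    and "countably_separated scaleK"
  shows "separable_space (weak_star_topology scaleK)"
proof -
  interpret locally_convex_hausdorff_space scaleK by (rule assms(1))
  have vs: "vector_space scaleK" ..
  obtain U :: "nat \<Rightarrow> 'a set" where
      U: "\<And>n. n \<ge> 1 \<Longrightarrow> absolutely_convex scaleK (U n)"
         "\<And>n. n \<ge> 1 \<Longrightarrow> null_neighborhood (U n)"
    and U0: "(\<Inter>n\<in>{1..}. {x. support_function (polar scaleK (U n)) x = 0}) = {0}"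
    using assms(3) unfolding countably_separated_def by metis
  define V where "V N = (\<Inter>n\<in>{1..N}. U n)" for N
  have V: "null_neighborhood (V N)" for N
  proof -
    have "open (\<Inter>n\<in>{1..N}. interior (U n))" "(\<Inter>n\<in>{1..N}. interior (U n)) \<subseteq> V N"
      using interior_subset by (fastforce simp: V_def)+
    moreover have "0 \<in> (\<Inter>n\<in>{1..N}. interior (U n))"
      using U(2) by (auto simp: null_neighborhood_def)
    ultimately show ?thesis
      unfolding null_neighborhood_def by (meson interior_maximal subset_iff)
  qed
  define H where "H N = {f \<in> continuous_dual scaleK. \<forall>x\<in>V N. norm (f x) \<le> real N}" for N
  define M where "M = (\<Union>N. H N)"
  have M: "M \<subseteq> continuous_dual scaleK"
    by (auto simp: M_def H_def)
  have zero: "(\<lambda>x. 0) \<in> M"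
    using zero_in_continuous_dual[OF vs] by (auto simp: M_def H_def)
  have comb: "(\<lambda>x. f x + a * h x) \<in> M" if fh: "f \<in> M" "h \<in> M" for f h a
  proof -
    obtain m n where mn: "f \<in> H m" "h \<in> H n"
      using fh by (auto simp: M_def)
    obtain l :: nat where l: "norm a \<le> real l"
      using real_arch_simple by blast
    \<comment> \<open>Large enough that \<open>V N\<close> lies in \<open>V m\<close> and \<open>V n\<close> and that \<open>N\<close> dominates \<open>m + norm a * n\<close>.\<close>
    define N where "N = m + n + l * n"
    have "norm (f x + a * h x) \<le> real N" if "x \<in> V N" for x
    proof -
      have "norm (f x) \<le> real m" "norm (h x) \<le> real n"
        using mn that by (auto simp: H_def V_def N_def)
      then have "norm (f x) + norm a * norm (h x) \<le> real m + real l * real n"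
        using l by (intro add_mono mult_mono) auto
      moreover have "norm (f x + a * h x) \<le> norm (f x) + norm a * norm (h x)"
        by (metis norm_mult norm_triangle_ineq)
      ultimately show ?thesis
        by (simp add: N_def)
    qed
    moreover have "(\<lambda>x. f x + a * h x) \<in> continuous_dual scaleK"
      using mn by (intro add_scale_in_continuous_dual[OF vs]) (auto simp: H_def)
    ultimately show ?thesis
      by (auto simp: M_def H_def)
  qed
  have polar_M: "polar scaleK (U n) \<subseteq> M" if "n \<ge> 1" for n
  proof
    fix f assume f: "f \<in> polar scaleK (U n)"
    \<comment> \<open>The bound \<open>1\<close> on \<open>U n\<close> is also a bound \<open>n\<close> on the smaller set \<open>V n\<close>, as \<open>n \<ge> 1\<close>.\<close>
    have "norm (f x) \<le> real n" if "x \<in> V n" for x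
      using polar_norm_le[OF vs U(1) f, of x] that \<open>n \<ge> 1\<close> by (auto simp: V_def)
    with f show "f \<in> M"
      by (auto simp: M_def H_def polar_def)
  qed
  have separating: "x = 0" if "\<And>f. f \<in> M \<Longrightarrow> f x = 0" for x
  proof -
    have "support_function (polar scaleK (U n)) x = 0" if "n \<ge> 1" for n
    proof (rule support_function_eq_0)
      have "(\<lambda>x. 0) \<in> polar scaleK (U n)"
        using zero_in_continuous_dual[OF vs] by (simp add: polar_def)
      then show "polar scaleK (U n) \<noteq> {}" by blast
    qed (use polar_M[OF \<open>n \<ge> 1\<close>] \<open>\<And>f. f \<in> M \<Longrightarrow> f x = 0\<close> in blast)
    then show ?thesis
      using U0 by auto
  qed
  have "\<exists>C. countable C \<and> C \<subseteq> H N \<and>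
    (\<forall>f\<in>H N. \<forall>F e. finite F \<longrightarrow> e > 0 \<longrightarrow> (\<exists>h\<in>C. \<forall>x\<in>F. norm (h x - f x) < e))" for N
    by (rule bounded_on_null_neighborhood_separable[OF assms(1,2) V[of N]]) (auto simp: H_def)
  then obtain C where C: "\<And>N. countable (C N)" "\<And>N. C N \<subseteq> H N"
    "\<And>N f F e. f \<in> H N \<Longrightarrow> finite F \<Longrightarrow> e > 0 \<Longrightarrow> \<exists>h\<in>C N. \<forall>x\<in>F. norm (h x - f x) < e"
    by metis
  define E where "E = (\<Union>N. C N)"
  have E_dual: "E \<subseteq> continuous_dual scaleK"
    using C(2) by (fastforce simp: E_def H_def)
  have "weak_star_topology scaleK closure_of E = continuous_dual scaleK"
  proof (intro equalityI subsetI)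
    fix g assume g: "g \<in> continuous_dual scaleK"
    show "g \<in> weak_star_topology scaleK closure_of E"
      unfolding in_closure_of
    proof (intro conjI allI impI)
      fix T assume T: "g \<in> T \<and> openin (weak_star_topology scaleK) T"
      obtain F e where F: "finite F" "e > 0"
        "{f \<in> continuous_dual scaleK. \<forall>x\<in>F. norm (f x - g x) < e} \<subseteq> T"
        using weak_star_basic_neighborhood[OF conjunct2[OF T] conjunct1[OF T]] by blast
      obtain f where f: "f \<in> M" "\<forall>x\<in>F. f x = g x"
        using separating_subspace_interpolates[OF vs M zero _ _ g F(1)] comb separating by blast
      obtain N where "f \<in> H N"
        using f(1) by (auto simp: M_def)
      with C(3) F(1,2) obtain h where h: "h \<in> C N" "\<forall>x\<in>F. norm (h x - f x) < e"
        by blast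
      then have "h \<in> E" by (auto simp: E_def)
      moreover have "h \<in> T"
        using h(2) f(2) \<open>h \<in> E\<close> E_dual by (intro subsetD[OF F(3)]) auto
      ultimately show "\<exists>h. h \<in> E \<and> h \<in> T" by blast
    qed (use g in simp)
  qed (simp add: in_closure_of)
  moreover have "countable E"
    using C(1) by (simp add: E_def)
  ultimately show ?thesis
    using E_dual by (auto simp: separable_space_def)
qed

end
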